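(* For each $n\ge3$, and each exchangeable random partition $\Pi_n$ of $[n]$ with exchangeable partition probability function (EPPF) $p$, the probability $u_{2:n}$ that the union of the first two blocks of $\Pi_n$ found in examining the elements of $[n]$ from left to right equals the union of the first two blocks found in examining the elements of $[n]$ from right to left is $$u_{2:n}=p(n)+(n-2)\,p(n-1,1)+\sum_{1<j<k<n}p(j-1+n-k,\,2)+\sum_{j=1}^{n-1}p(j,\,n-j)+\sum_{1<j<k<n}p(j,\,n-k+1).$$
   Context: $[n]:=\{1,\ldots,n\}$. $\Pi_n$ is the $n$-th term of a consistent sequence $(\Pi_m)_{m\ge1}$ of exchangeable random partitions: $\Pi_m$ is a random partition of $[m]$ whose law is invariant under permutations of $[m]$, and the restriction of $\Pi_m$ to $[n]$ is $\Pi_n$ for $n<m$. Its EPPF $p$ is the function of compositions $(n_1,\ldots,n_k)$ of positive integers such that, with $n'=n_1+\cdots+n_k$, for every $m\ge n'$ the number $p(n_1,\ldots,n_k)$ is the probability that the restriction of $\Pi_m$ to $[n']$ equals any particular partition of $[n']$ with blocks of sizes $n_1,\ldots,n_k$; by exchangeability, the same holds for the restriction of $\Pi_m$ to any $n'$-element subset of $[m]$. Order of discovery of blocks: from left to right, the first block $C_1$ is the block containing $1$, and the second block $C_2$ is the block containing the least element of $[n]\setminus C_1$ (with $C_2=\emptyset$ if $C_1=[n]$). From right to left, the first block $R_1$ is the block containing $n$, and the second block $R_2$ is the block containing the greatest element of $[n]\setminus R_1$ (with $R_2=\emptyset$ if $R_1=[n]$). Thus $u_{2:n}:=\mathbb P(C_1\cup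 C_2=R_1\cup R_2)$. Sums over empty index sets are $0$. *)

theory Defs
  imports "HOL-Probability.Probability" "HOL-Combinatorics.Permutations" "HOL-Library.Disjoint_Sets"
begin

definition set_partitions :: "nat \<Rightarrow> nat set set set" where
  "set_partitions n = {P. partition_on {1..n} P}"

definition restrict_partition :: "nat set \<Rightarrow> nat set set \<Rightarrow> nat set set" where
  "restrict_partition B P = (\<lambda>C. B \<inter> C) ` P - {{}}"

definition permute_partition :: "(nat \<Rightarrow> nat) \<Rightarrow> nat set set \<Rightarrow> nat set set" where
  "permute_partition \<sigma> P = (\<lambda>C. \<sigma> ` C) ` P"

definition random_partition :: "'a measure \<Rightarrow> nat \<Rightarrow> ('a \<Rightarrow> nat set set) \<Rightarrow> bool" where
  "random_partition M n X \<longleftrightarrow> X \<in> measurable M (count_space (set_partitions n))"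

definition exchangeable_partition :: "'a measure \<Rightarrow> nat \<Rightarrow> ('a \<Rightarrow> nat set set) \<Rightarrow> bool" where
  "exchangeable_partition M n X \<longleftrightarrow>
     random_partition M n X \<and>
     (\<forall>\<sigma>. \<sigma> permutes {1..n} \<longrightarrow>
        distr M (count_space (set_partitions n)) (\<lambda>\<omega>. permute_partition \<sigma> (X \<omega>)) =
        distr M (count_space (set_partitions n)) X)"

(* The sequence is indexed by m >= 1, so the value at index 0 is left unconstrained.
   Consistency is an identity of random variables and is therefore only required
   almost surely. *)
definition consistent_exchangeable_partitions ::
  "'a measure \<Rightarrow> (nat \<Rightarrow> 'a \<Rightarrow> nat set set) \<Rightarrow> bool" where
  "consistent_exchangeable_partitions M X \<longleftrightarrow>
     (\<forall>m\<ge>1. exchangeable_partition M m (X m)) \<and>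
     (\<forall>m n. 1 \<le> n \<and> n < m \<longrightarrow>
        (AE \<omega> in M. restrict_partition {1..n} (X m \<omega>) = X n \<omega>))"

definition composition :: "nat list \<Rightarrow> bool" where
  "composition ns \<longleftrightarrow> ns \<noteq> [] \<and> (\<forall>i\<in>set ns. 0 < i)"

(* The values of an EPPF on lists that are not compositions are irrelevant and not
   constrained.  The blocks of P carry no order, so "blocks of sizes n_1, ..., n_k" is
   an equality of multisets. *)
definition is_EPPF ::
  "(nat list \<Rightarrow> real) \<Rightarrow> 'a measure \<Rightarrow> (nat \<Rightarrow> 'a \<Rightarrow> nat set set) \<Rightarrow> bool" where
  "is_EPPF p M X \<longleftrightarrow>
     (\<forall>ns. composition ns \<longrightarrow>
        (\<forall>m\<ge>sum_list ns. \<forall>P\<in>set_partitions (sum_list ns).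
           image_mset card (mset_set P) = mset ns \<longrightarrow>
           measure M {\<omega> \<in> space M. restrict_partition {1..sum_list ns} (X m \<omega>) = P} = p ns))"

definition block_of :: "nat set set \<Rightarrow> nat \<Rightarrow> nat set" where
  "block_of P x = (THE C. C \<in> P \<and> x \<in> C)"

definition first_left :: "nat \<Rightarrow> nat set set \<Rightarrow> nat set" where
  "first_left n P = block_of P 1"

definition second_left :: "nat \<Rightarrow> nat set set \<Rightarrow> nat set" where
  "second_left n P =
     (if first_left n P = {1..n} then {} else block_of P (Min ({1..n} - first_left n P)))"

definition first_right :: "nat \<Rightarrow> nat set set \<Rightarrow> nat set" where
  "first_right n P = block_of P n"

definition second_right :: "nat \<Rightarrow> nat set set \<Rightarrow> nat set" where
  "second_right n P =
     (if first_right n P = {1..n} then {} else block_of P (Max ({1..n} - first_right n P)))"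

definition u2 :: "'a measure \<Rightarrow> (nat \<Rightarrow> 'a \<Rightarrow> nat set set) \<Rightarrow> nat \<Rightarrow> real" where
  "u2 M X n =
     measure M {\<omega> \<in> space M.
       first_left n (X n \<omega>) \<union> second_left n (X n \<omega>) =
       first_right n (X n \<omega>) \<union> second_right n (X n \<omega>)}"

end

theory Submission
  imports Defs
begin

text \<open>
  Let \<open>L\<close> and \<open>R\<close> be the blocks of \<open>1\<close> and of \<open>n\<close>, let \<open>j\<close> be the least element outside \<open>L\<close> and
  \<open>k\<close> the greatest element outside \<open>R\<close>. Distinct blocks are disjoint and nonempty, so unless there is
  only one block the two unions agree exactly when the pairs \<open>{L, block of j}\<close> and
  \<open>{R, block of k}\<close> agree. This can happen in two ways.

  \<^item> Nested: \<open>L = R\<close>, and \<open>j\<close>, \<open>k\<close> share a block. Then \<open>j \<le> k\<close>, and the restriction of the partition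
    to \<open>{1..j} \<union> {k..n}\<close> has the two blocks \<open>{1..<j} \<union> {k<..n}\<close> and \<open>{j, k}\<close>.
  \<^item> Crossed: \<open>L \<noteq> R\<close>, \<open>j \<in> R\<close> and \<open>k \<in> L\<close>. Then either \<open>j < k\<close> or \<open>j = k + 1\<close>, and the restriction to
    the same kind of set has the two blocks \<open>{1..<j} \<union> {k}\<close> and \<open>{j} \<union> {k<..n}\<close>.

  Conversely, each of these restricted partitions forces \<open>j\<close> and \<open>k\<close> to be those extreme elements, so
  different patterns are disjoint events (\<open>separates_nested_iff\<close>, \<open>separates_crossed_iff\<close>,
  \<open>two_block_unions_eq_iff\<close>). By exchangeability, a pattern has the EPPF of its two block sizes as its
  probability (\<open>measure_separates\<close>). The one-block partition gives \<open>p(n)\<close>; the nested patterns with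
  \<open>j = k\<close> give the \<open>n - 2\<close> equal terms \<open>p(n-1,1)\<close> and those with \<open>j < k\<close> the first double sum; the
  crossed patterns with \<open>j = k + 1\<close> are the partitions into two intervals and give the single sum,
  those with \<open>j < k\<close> the last double sum.
\<close>

section \<open>Restrictions of an exchangeable partition to arbitrary subsets\<close>

lemma ex_permutes_image_eq_initial_segment:
  assumes "S \<subseteq> {1..n}"
  shows "\<exists>\<sigma>. \<sigma> permutes {1..n} \<and> \<sigma> ` S = {1..card S}"
proof -
  let ?T = "{1..n} - S" and ?J = "{1..n} - {1..card S}"
  have fin: "finite S" using assms finite_subset by blast
  have "card S \<le> n" using card_mono[OF _ assms] by simp
  then have J: "{1..card S} \<subseteq> {1..n}" by auto
  obtain f where f: "bij_betw f S {1..card S}"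
    using finite_same_card_bij[OF fin, of "{1..card S}"] by auto
  have "card ?T = card ?J"
    using assms J fin by (simp add: card_Diff_subset)
  then obtain g where g: "bij_betw g ?T ?J"
    using finite_same_card_bij[of ?T ?J] by auto
  define \<sigma> where "\<sigma> = (\<lambda>x. if x \<in> S then f x else if x \<in> ?T then g x else x)"
  have 1: "bij_betw \<sigma> S {1..card S}"
    using f by (rule bij_betw_cong[THEN iffD1, rotated]) (auto simp: \<sigma>_def)
  have 2: "bij_betw \<sigma> ?T ?J"
    using g by (rule bij_betw_cong[THEN iffD1, rotated]) (auto simp: \<sigma>_def)
  have "bij_betw \<sigma> (S \<union> ?T) ({1..card S} \<union> ?J)"
    by (rule bij_betw_combine[OF 1 2]) auto
  moreover have "S \<union> ?T = {1..n}" "{1..card S} \<union> ?J = {1..n}" using assms J by auto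
  ultimately have "bij_betw \<sigma> {1..n} {1..n}" by simp
  then have "\<sigma> permutes {1..n}"
    by (rule bij_imp_permutes) (use assms in \<open>auto simp: \<sigma>_def\<close>)
  moreover have "\<sigma> ` S = {1..card S}" using 1 by (simp add: bij_betw_def)
  ultimately show ?thesis by blast
qed

lemma restrict_partition_whole:
  assumes "partition_on U P"
  shows "restrict_partition U P = P"
proof -
  have "U \<inter> C = C" if "C \<in> P" for C using partition_onD1[OF assms] that by blast
  then have "(\<lambda>C. U \<inter> C) ` P = P" by simp
  then show ?thesis using partition_onD3[OF assms] by (simp add: restrict_partition_def)
qed

lemma partition_on_permute_partition:
  assumes "partition_on A P" "inj \<sigma>"
  shows "partition_on (\<sigma> ` A) (permute_partition \<sigma> P)"
proof -
  have "{} \<notin> (`) \<sigma> ` P" using partition_onD3[OF assms(1)] by auto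
  then show ?thesis
    using partition_on_inj_image[OF assms(1) inj_on_subset[OF assms(2)]]
    by (simp add: permute_partition_def)
qed

lemma restrict_permute_partition:
  assumes "inj \<sigma>"
  shows "restrict_partition (\<sigma> ` S) (permute_partition \<sigma> P) =
         permute_partition \<sigma> (restrict_partition S P)"
proof -
  have "\<sigma> ` S \<inter> \<sigma> ` C = \<sigma> ` (S \<inter> C)" for C
    using assms by (simp add: image_Int)
  then show ?thesis
    by (auto simp: restrict_partition_def permute_partition_def image_image)
qed

lemma permute_partition_eq_iff:
  assumes "inj \<sigma>"
  shows "permute_partition \<sigma> P = permute_partition \<sigma> Q \<longleftrightarrow> P = Q"
proof -
  have "inj ((`) \<sigma>)" using assms by (simp add: inj_def inj_image_eq_iff)
  then show ?thesis unfolding permute_partition_def by (rule inj_image_eq_iff)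
qed

lemma random_partition_event_sets:
  assumes "random_partition M n Y"
  shows "{\<omega> \<in> space M. Q (Y \<omega>)} \<in> sets M"
proof -
  have Y: "Y \<in> measurable M (count_space (set_partitions n))"
    using assms by (simp add: random_partition_def)
  have "Y -` {P \<in> set_partitions n. Q P} \<inter> space M \<in> sets M"
    using Y by (rule measurable_sets) auto
  also have "Y -` {P \<in> set_partitions n. Q P} \<inter> space M = {\<omega> \<in> space M. Q (Y \<omega>)}"
    using measurable_space[OF Y] by auto
  finally show ?thesis .
qed

lemma random_partition_partition_on:
  assumes "random_partition M n Y" "\<omega> \<in> space M"
  shows "partition_on {1..n} (Y \<omega>)"
proof -
  have "Y \<in> measurable M (count_space (set_partitions n))"
    using assms(1) by (simp add: random_partition_def)
  from measurable_space[OF this assms(2)] show ?thesis by (simp add: set_partitions_def)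
qed

text \<open>Exchangeability equates laws on the discrete space of partitions, where every predicate
  defines a measurable event.\<close>

lemma measure_permute_partition_event:
  assumes "exchangeable_partition M n Y" "\<sigma> permutes {1..n}"
  shows "measure M {\<omega> \<in> space M. Q (permute_partition \<sigma> (Y \<omega>))} =
         measure M {\<omega> \<in> space M. Q (Y \<omega>)}"
proof -
  let ?C = "count_space (set_partitions n)"
  let ?A = "{P \<in> set_partitions n. Q P}"
  have Y: "Y \<in> measurable M ?C"
    and D: "distr M ?C (\<lambda>\<omega>. permute_partition \<sigma> (Y \<omega>)) = distr M ?C Y"
    using assms by (auto simp: exchangeable_partition_def random_partition_def)
  have "permute_partition \<sigma> P \<in> set_partitions n" if "P \<in> set_partitions n" for P
    using that partition_on_permute_partition[OF _ permutes_inj[OF assms(2)], of "{1..n}" P]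
      permutes_image[OF assms(2)]
    by (simp add: set_partitions_def)
  then have "permute_partition \<sigma> \<in> measurable ?C ?C" by simp
  then have Z: "(\<lambda>\<omega>. permute_partition \<sigma> (Y \<omega>)) \<in> measurable M ?C"
    using measurable_compose[OF Y] by blast
  have "measure M {\<omega> \<in> space M. Q (permute_partition \<sigma> (Y \<omega>))} =
        measure (distr M ?C (\<lambda>\<omega>. permute_partition \<sigma> (Y \<omega>))) ?A"
    by (subst measure_distr[OF Z])
       (use measurable_space[OF Z] in \<open>auto intro!: arg_cong[where f = "measure M"]\<close>)
  also have "\<dots> = measure M {\<omega> \<in> space M. Q (Y \<omega>)}"
    unfolding D
    by (subst measure_distr[OF Y])
       (use measurable_space[OF Y] in \<open>auto intro!: arg_cong[where f = "measure M"]\<close>)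
  finally show ?thesis .
qed

text \<open>The EPPF is tied to the initial segments only. A permutation of \<open>{1..n}\<close> that carries \<open>S\<close> to
  \<open>{1..card S}\<close> turns the restriction to \<open>S\<close> into the restriction of a relabelled partition to that
  segment, and relabelling preserves both the law and the block sizes.\<close>

lemma measure_restrict_partition_eq:
  assumes exch: "exchangeable_partition M n (X n)" and eppf: "is_EPPF p M X"
    and S: "S \<subseteq> {1..n}" and Q: "partition_on S Q"
    and ns: "composition ns" "image_mset card (mset_set Q) = mset ns"
  shows "measure M {\<omega> \<in> space M. restrict_partition S (X n \<omega>) = Q} = p ns"
proof -
  obtain \<sigma> where \<sigma>: "\<sigma> permutes {1..n}" "\<sigma> ` S = {1..card S}"
    using ex_permutes_image_eq_initial_segment[OF S] by blast
  have inj: "inj \<sigma>" using \<sigma>(1) by (rule permutes_inj)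
  have finS: "finite S" using S finite_subset by blast
  have "card S = sum card Q"
    using partition_onD1[OF Q] partition_onD2[OF Q] finS
    by (metis card_Union_disjoint finite_subset Union_upper)
  also have "\<dots> = sum_mset (image_mset card (mset_set Q))" by (simp add: sum_unfold_sum_mset)
  also have "\<dots> = sum_list ns" using ns by (simp add: sum_mset_sum_list)
  finally have sum: "sum_list ns = card S" ..
  have Q': "permute_partition \<sigma> Q \<in> set_partitions (card S)"
    using partition_on_permute_partition[OF Q inj] \<sigma>(2) by (simp add: set_partitions_def)
  have "inj_on ((`) \<sigma>) Q" using inj by (simp add: inj_on_def inj_image_eq_iff)
  then have "image_mset card (mset_set (permute_partition \<sigma> Q)) =
             image_mset (\<lambda>C. card (\<sigma> ` C)) (mset_set Q)"
    by (simp add: permute_partition_def image_mset_mset_set[symmetric] image_mset.compositionality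
        comp_def)
  also have "\<dots> = mset ns"
    using inj ns(2) by (simp add: card_image inj_on_subset)
  finally have sizes: "image_mset card (mset_set (permute_partition \<sigma> Q)) = mset ns" .
  have "restrict_partition S P = Q \<longleftrightarrow>
        restrict_partition {1..card S} (permute_partition \<sigma> P) = permute_partition \<sigma> Q" for P
    unfolding \<sigma>(2)[symmetric] restrict_permute_partition[OF inj]
      permute_partition_eq_iff[OF inj] ..
  then have "measure M {\<omega> \<in> space M. restrict_partition S (X n \<omega>) = Q} =
        measure M {\<omega> \<in> space M. restrict_partition {1..card S} (permute_partition \<sigma> (X n \<omega>)) =
                                permute_partition \<sigma> Q}"
    by simp
  also have "\<dots> = measure M {\<omega> \<in> space M. restrict_partition {1..card S} (X n \<omega>) =
                                          permute_partition \<sigma> Q}"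
    by (rule measure_permute_partition_event[OF exch \<sigma>(1)])
  also have "\<dots> = p ns"
    using eppf[unfolded is_EPPF_def, rule_format, of ns n "permute_partition \<sigma> Q"]
      ns(1) Q' sizes card_mono[OF _ S] unfolding sum by simp
  finally show ?thesis .
qed

text \<open>A restriction with exactly two prescribed blocks is easier to handle as a statement about the
  blocks of the unrestricted partition; \<open>separates_iff_restrict_partition\<close> gives the translation.\<close>

definition separates :: "nat set set \<Rightarrow> nat set \<Rightarrow> nat set \<Rightarrow> bool" where
  "separates P A B \<longleftrightarrow> (\<exists>C\<in>P. \<exists>D\<in>P. C \<noteq> D \<and> A \<subseteq> C \<and> B \<subseteq> D)"

lemma partition_on_unique_block:
  "partition_on U P \<Longrightarrow> C \<in> P \<Longrightarrow> D \<in> P \<Longrightarrow> x \<in> C \<Longrightarrow> x \<in> D \<Longrightarrow> C = D"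
  by (meson disjointD disjoint_iff partition_onD2)

lemma separates_iff_restrict_partition:
  assumes P: "partition_on U P" and "A \<noteq> {}" "B \<noteq> {}" "A \<inter> B = {}" "A \<union> B \<subseteq> U"
  shows "separates P A B \<longleftrightarrow> restrict_partition (A \<union> B) P = {A, B}"
proof
  assume "separates P A B"
  then obtain C D where CD: "C \<in> P" "D \<in> P" "C \<noteq> D" "A \<subseteq> C" "B \<subseteq> D"
    by (auto simp: separates_def)
  have disj: "C \<inter> D = {}" using partition_on_unique_block[OF P] CD by blast
  then have [simp]: "(A \<union> B) \<inter> C = A" "(A \<union> B) \<inter> D = B" using CD by auto
  have "(A \<union> B) \<inter> E = {}" if "E \<in> P" "E \<noteq> C" "E \<noteq> D" for E
    using partition_on_unique_block[OF P] that CD by blast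
  then have "(\<lambda>E. (A \<union> B) \<inter> E) ` P - {{}} \<subseteq> {A, B}"
    using \<open>(A \<union> B) \<inter> C = A\<close> \<open>(A \<union> B) \<inter> D = B\<close> by blast
  moreover have "{A, B} \<subseteq> (\<lambda>E. (A \<union> B) \<inter> E) ` P - {{}}"
    using imageI[OF CD(1), of "\<lambda>E. (A \<union> B) \<inter> E"] imageI[OF CD(2), of "\<lambda>E. (A \<union> B) \<inter> E"]
      assms(2,3) by simp
  ultimately show "restrict_partition (A \<union> B) P = {A, B}"
    unfolding restrict_partition_def by blast
next
  assume "restrict_partition (A \<union> B) P = {A, B}"
  then have "A \<in> (\<lambda>C. (A \<union> B) \<inter> C) ` P" "B \<in> (\<lambda>C. (A \<union> B) \<inter> C) ` P"
    unfolding restrict_partition_def by blast+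
  then obtain C D where CD: "C \<in> P" "A = (A \<union> B) \<inter> C" "D \<in> P" "B = (A \<union> B) \<inter> D" by blast
  moreover have "C \<noteq> D" using CD assms(2-4) by blast
  ultimately show "separates P A B" unfolding separates_def by blast
qed

lemma measure_separates:
  assumes exch: "exchangeable_partition M n (X n)" and eppf: "is_EPPF p M X"
    and AB: "A \<noteq> {}" "B \<noteq> {}" "A \<inter> B = {}" "A \<union> B \<subseteq> {1..n}"
  shows "measure M {\<omega> \<in> space M. separates (X n \<omega>) A B} = p [card A, card B]"
proof -
  have fin: "finite A" "finite B" using AB(4) finite_subset[of _ "{1..n}"] by auto
  have "A \<noteq> B" using AB by auto
  have part: "partition_on {1..n} (X n \<omega>)" if "\<omega> \<in> space M" for \<omega>
    using exch that random_partition_partition_on by (auto simp: exchangeable_partition_def)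
  have "measure M {\<omega> \<in> space M. separates (X n \<omega>) A B} =
        measure M {\<omega> \<in> space M. restrict_partition (A \<union> B) (X n \<omega>) = {A, B}}"
    using separates_iff_restrict_partition[OF part AB]
    by (intro arg_cong[where f = "measure M"]) auto
  also have "\<dots> = p [card A, card B]"
  proof (rule measure_restrict_partition_eq[OF exch eppf AB(4)])
    show "partition_on (A \<union> B) {A, B}"
      using AB by (auto simp: partition_on_def disjoint_def)
    show "composition [card A, card B]"
      using AB fin by (auto simp: composition_def card_gt_0_iff)
    show "image_mset card (mset_set {A, B}) = mset [card A, card B]"
      using \<open>A \<noteq> B\<close> by simp
  qed
  finally show ?thesis .
qed


section \<open>Agreement of the left-to-right and right-to-left explorations\<close>

lemma block_of_eqI:
  assumes "partition_on U P" "C \<in> P" "x \<in> C"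
  shows "block_of P x = C"
  unfolding block_of_def
proof (rule the_equality)
  show "D = C" if "D \<in> P \<and> x \<in> D" for D
    using partition_on_unique_block[OF assms(1), of D C x] that assms by blast
qed (use assms in blast)

lemma block_of_mem:
  assumes "partition_on U P" "x \<in> U"
  shows "block_of P x \<in> P" "x \<in> block_of P x"
proof -
  obtain C where C: "C \<in> P" "x \<in> C" using assms(2) partition_onD1[OF assms(1)] by blast
  then have "block_of P x = C" by (rule block_of_eqI[OF assms(1)])
  with C show "block_of P x \<in> P" "x \<in> block_of P x" by simp_all
qed

lemma block_of_subset:
  "partition_on U P \<Longrightarrow> x \<in> U \<Longrightarrow> block_of P x \<subseteq> U"
  using block_of_mem(1)[of U P x] partition_onD1[of U P] by blast

lemma block_of_eq_iff:
  assumes "partition_on U P" "x \<in> U" "y \<in> U"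
  shows "block_of P y = block_of P x \<longleftrightarrow> y \<in> block_of P x"
  using block_of_eqI[OF assms(1) block_of_mem(1)[OF assms(1,2)]] block_of_mem(2)[OF assms(1,3)]
  by auto

text \<open>This turns the equality of two unions of discovered blocks into an equality of the sets of
  discovered blocks.\<close>

lemma partition_on_Union_eq_iff:
  assumes P: "partition_on U P" and "\<A> \<subseteq> P" "\<B> \<subseteq> P"
  shows "\<Union>\<A> = \<Union>\<B> \<longleftrightarrow> \<A> = \<B>"
proof -
  have "\<C> \<subseteq> \<D>" if sub: "\<C> \<subseteq> P" "\<D> \<subseteq> P" "\<Union>\<C> \<subseteq> \<Union>\<D>" for \<C> \<D>
  proof
    fix C assume C: "C \<in> \<C>"
    then have "C \<noteq> {}" using sub(1) partition_onD3[OF P] by blast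
    then obtain x where x: "x \<in> C" by blast
    then obtain D where "D \<in> \<D>" "x \<in> D" using sub(3) C x by blast
    then show "C \<in> \<D>" using partition_on_unique_block[OF P, of C D x] sub x C by blast
  qed
  then show ?thesis using assms by (metis order_refl subset_antisym)
qed

lemma block_of_eq_whole_iff:
  assumes P: "partition_on U P" and x: "x \<in> U"
  shows "block_of P x = U \<longleftrightarrow> P = {U}"
proof
  assume "block_of P x = U"
  then have "{U} \<subseteq> P" using block_of_mem(1)[OF assms] by simp
  moreover have "\<Union>P = \<Union>{U}" using partition_onD1[OF P] by simp
  ultimately show "P = {U}" using partition_on_Union_eq_iff[OF P order_refl] by metis
next
  assume "P = {U}"
  then show "block_of P x = U" using block_of_mem(1)[OF assms] by simp
qed

text \<open>The breaks are the elements that start the second block in either direction of exploration. They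
  are meaningful if there are at least two blocks; otherwise \<open>Min\<close> and \<open>Max\<close> are taken of the empty
  set.\<close>

definition left_break :: "nat \<Rightarrow> nat set set \<Rightarrow> nat" where
  "left_break n P = Min ({1..n} - block_of P 1)"

definition right_break :: "nat \<Rightarrow> nat set set \<Rightarrow> nat" where
  "right_break n P = Max ({1..n} - block_of P n)"

lemma left_break_props:
  assumes P: "partition_on {1..n} P" and n: "1 \<le> n" and ne: "block_of P 1 \<noteq> {1..n}"
  shows "1 < left_break n P" "left_break n P \<le> n" "left_break n P \<notin> block_of P 1"
    "{1..<left_break n P} \<subseteq> block_of P 1"
proof -
  let ?V = "{1..n} - block_of P 1"
  have V: "finite ?V" "?V \<noteq> {}"
    using block_of_subset[OF P, of 1] n ne by auto
  have mem: "left_break n P \<in> ?V" unfolding left_break_def by (rule Min_in[OF V])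
  then show "left_break n P \<le> n" "left_break n P \<notin> block_of P 1" by auto
  have "1 \<in> block_of P 1" using block_of_mem(2)[OF P] n by simp
  then have "left_break n P \<noteq> 1" using mem by auto
  then show "1 < left_break n P" using mem by simp
  show "{1..<left_break n P} \<subseteq> block_of P 1"
  proof
    fix x assume x: "x \<in> {1..<left_break n P}"
    show "x \<in> block_of P 1"
    proof (rule ccontr)
      assume "x \<notin> block_of P 1"
      then have "x \<in> ?V" using x mem by simp
      then have "left_break n P \<le> x" unfolding left_break_def by (rule Min_le[OF V(1)])
      then show False using x by simp
    qed
  qed
qed

lemma right_break_props:
  assumes P: "partition_on {1..n} P" and n: "1 \<le> n" and ne: "block_of P n \<noteq> {1..n}"
  shows "1 \<le> right_break n P" "right_break n P < n" "right_break n P \<notin> block_of P n"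
    "{right_break n P<..n} \<subseteq> block_of P n"
proof -
  let ?V = "{1..n} - block_of P n"
  have V: "finite ?V" "?V \<noteq> {}"
    using block_of_subset[OF P, of n] n ne by auto
  have mem: "right_break n P \<in> ?V" unfolding right_break_def by (rule Max_in[OF V])
  then show "1 \<le> right_break n P" "right_break n P \<notin> block_of P n" by auto
  have "n \<in> block_of P n" using block_of_mem(2)[OF P] n by simp
  then have "right_break n P \<noteq> n" using mem by auto
  then show "right_break n P < n" using mem by simp
  show "{right_break n P<..n} \<subseteq> block_of P n"
  proof
    fix x assume x: "x \<in> {right_break n P<..n}"
    show "x \<in> block_of P n"
    proof (rule ccontr)
      assume "x \<notin> block_of P n"
      then have "x \<in> ?V" using x mem by simp
      then have "x \<le> right_break n P" unfolding right_break_def by (rule Max_ge[OF V(1)])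
      then show False using x by simp
    qed
  qed
qed

lemma left_break_eqI:
  assumes "j \<in> {1..n}" "j \<notin> block_of P 1" "{1..<j} \<subseteq> block_of P 1"
  shows "left_break n P = j"
  unfolding left_break_def
proof (rule Min_eqI)
  fix y assume "y \<in> {1..n} - block_of P 1"
  then show "j \<le> y" using assms(3) by (auto simp: subset_iff not_less[symmetric])
qed (use assms in auto)

lemma right_break_eqI:
  assumes "k \<in> {1..n}" "k \<notin> block_of P n" "{k<..n} \<subseteq> block_of P n"
  shows "right_break n P = k"
  unfolding right_break_def
proof (rule Max_eqI)
  fix y assume "y \<in> {1..n} - block_of P n"
  then show "y \<le> k" using assms(3) by (auto simp: subset_iff not_less[symmetric])
qed (use assms in auto)

text \<open>Fixing where \<open>{1..<j} \<union> {k<..n}\<close> and \<open>{j, k}\<close> lie is enough to know both breaks: \<open>j\<close> is the first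
  element outside the block of \<open>1\<close>, and \<open>k\<close> the last one. The right-hand side hence determines
  \<open>(j, k)\<close> from the partition, which makes the patterns mutually exclusive.\<close>

lemma separates_nested_iff:
  assumes P: "partition_on {1..n} P" and jk: "1 < j" "j \<le> k" "k < n"
  shows "separates P ({1..<j} \<union> {k<..n}) {j, k} \<longleftrightarrow>
     block_of P 1 \<noteq> {1..n} \<and> block_of P 1 = block_of P n \<and> block_of P j = block_of P k \<and>
     left_break n P = j \<and> right_break n P = k" (is "?S \<longleftrightarrow> ?R")
proof
  assume ?S
  then obtain C D where CD: "C \<in> P" "D \<in> P" "C \<noteq> D" "{1..<j} \<union> {k<..n} \<subseteq> C" "{j, k} \<subseteq> D"
    unfolding separates_def by blast
  have [simp]: "block_of P 1 = C" "block_of P n = C" "block_of P j = D" "block_of P k = D"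
    using CD jk by (auto intro!: block_of_eqI[OF P])
  have notin: "j \<notin> C" "k \<notin> C" using CD partition_on_unique_block[OF P] by blast+
  have "left_break n P = j" using CD notin jk by (intro left_break_eqI) (auto simp del: One_nat_def)
  moreover have "right_break n P = k" using CD notin jk by (intro right_break_eqI) (auto simp del: One_nat_def)
  ultimately show ?R using notin jk by (auto simp del: One_nat_def)
next
  assume R: ?R
  then have ne: "block_of P 1 \<noteq> {1..n}" "block_of P n \<noteq> {1..n}"
    and same: "block_of P n = block_of P 1" "block_of P k = block_of P j"
    and breaks: "left_break n P = j" "right_break n P = k" by metis+
  have n: "1 \<le> n" using jk by simp
  note l = left_break_props[OF P n ne(1), unfolded breaks]
  note r = right_break_props[OF P n ne(2), unfolded breaks same]
  have C: "block_of P 1 \<in> P" using block_of_mem(1)[OF P, of 1] n by simp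
  have D: "block_of P j \<in> P" "j \<in> block_of P j" "k \<in> block_of P j"
    using block_of_mem[OF P, of j] block_of_mem(2)[OF P, of k] l r unfolding same by simp_all
  have "block_of P 1 \<noteq> block_of P j" using D l by metis
  moreover have "{1..<j} \<union> {k<..n} \<subseteq> block_of P 1" using l(4) r(4) by (rule Un_least)
  ultimately show ?S unfolding separates_def using C D by blast
qed

text \<open>The counterpart for different blocks of \<open>1\<close> and \<open>n\<close>: the left break lies in the block of \<open>n\<close> and
  the right break in the block of \<open>1\<close>. Here \<open>k < j\<close> is possible; for \<open>k = j - 1\<close> the elements \<open>k\<close> and \<open>j\<close>
  already belong to the intervals into which they are inserted.\<close>

lemma separates_crossed_iff:
  assumes P: "partition_on {1..n} P" and jk: "1 < j" "j \<le> n" "1 \<le> k" "k < n"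
  shows "separates P (insert k {1..<j}) (insert j {k<..n}) \<longleftrightarrow>
     block_of P 1 \<noteq> block_of P n \<and> block_of P j = block_of P n \<and> block_of P k = block_of P 1 \<and>
     left_break n P = j \<and> right_break n P = k" (is "?S \<longleftrightarrow> ?R")
proof
  assume ?S
  then obtain C D where CD: "C \<in> P" "D \<in> P" "C \<noteq> D" "insert k {1..<j} \<subseteq> C" "insert j {k<..n} \<subseteq> D"
    unfolding separates_def by blast
  have [simp]: "block_of P 1 = C" "block_of P n = D" "block_of P j = D" "block_of P k = C"
    using CD jk by (auto intro!: block_of_eqI[OF P])
  have notin: "j \<notin> C" "k \<notin> D" using CD partition_on_unique_block[OF P] by blast+
  have "left_break n P = j" using CD notin jk by (intro left_break_eqI) (auto simp del: One_nat_def)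
  moreover have "right_break n P = k" using CD notin jk by (intro right_break_eqI) (auto simp del: One_nat_def)
  ultimately show ?R using \<open>C \<noteq> D\<close> by (simp del: One_nat_def)
next
  assume R: ?R
  then have neq: "block_of P 1 \<noteq> block_of P n"
    and blocks: "block_of P j = block_of P n" "block_of P k = block_of P 1"
    and breaks: "left_break n P = j" "right_break n P = k" by metis+
  have n: "1 \<le> n" and ends: "1 \<in> {1..n}" "n \<in> {1..n}" using jk by simp_all
  have ne: "block_of P 1 \<noteq> {1..n}" "block_of P n \<noteq> {1..n}"
    using block_of_eq_iff[OF P ends] block_of_eq_iff[OF P ends(2,1)] neq ends by metis+
  note l = left_break_props[OF P n ne(1), unfolded breaks]
  note r = right_break_props[OF P n ne(2), unfolded breaks]
  have C: "block_of P 1 \<in> P" "k \<in> block_of P 1"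
    using block_of_mem(1)[OF P, of 1] block_of_mem(2)[OF P, of k] n jk unfolding blocks by simp_all
  have D: "block_of P n \<in> P" "j \<in> block_of P n"
    using block_of_mem(1)[OF P, of n] block_of_mem(2)[OF P, of j] n jk unfolding blocks by simp_all
  show ?S unfolding separates_def using C D neq l(4) r(4) by blast
qed

text \<open>The index sets list the pairs of breaks that can occur. In the crossed case \<open>j = k\<close> is impossible,
  since \<open>j\<close> lies outside the block of \<open>1\<close> and \<open>k\<close> inside it; and if \<open>k < j\<close> then the elements strictly
  between them would lie in the blocks of both \<open>1\<close> and \<open>n\<close>, so there are none.\<close>

definition nested_indices :: "nat \<Rightarrow> (nat \<times> nat) set" where
  "nested_indices n = {(j, k). 1 < j \<and> j \<le> k \<and> k < n}"

definition crossed_indices :: "nat \<Rightarrow> (nat \<times> nat) set" where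
  "crossed_indices n = {(j, k). 1 < j \<and> j \<le> n \<and> 1 \<le> k \<and> k < n \<and> (j < k \<or> j = Suc k)}"

lemma two_block_unions_eq_iff:
  assumes P: "partition_on {1..n} P" and n: "1 \<le> n"
  shows "first_left n P \<union> second_left n P = first_right n P \<union> second_right n P \<longleftrightarrow>
      block_of P 1 = {1..n} \<or>
      (\<exists>(j, k)\<in>nested_indices n. separates P ({1..<j} \<union> {k<..n}) {j, k}) \<or>
      (\<exists>(j, k)\<in>crossed_indices n. separates P (insert k {1..<j}) (insert j {k<..n}))"
    (is "?E \<longleftrightarrow> ?T \<or> ?N \<or> ?K")
proof (cases ?T)
  case True
  then have R: "block_of P n = {1..n}" using block_of_eq_iff[OF P, of 1 n] n by simp
  have ?E
    unfolding first_left_def second_left_def first_right_def second_right_def True R by simp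
  then show ?thesis using True by metis
next
  case False
  define j where "j = left_break n P"
  define k where "k = right_break n P"
  let ?L = "block_of P 1" and ?R = "block_of P n"
  have mem1: "1 \<in> {1..n}" "n \<in> {1..n}" using n by simp_all
  then have R: "?R \<noteq> {1..n}" using False block_of_eq_iff[OF P, of n 1] by metis
  note j = left_break_props[OF P n False, folded j_def]
  note k = right_break_props[OF P n R, folded k_def]
  have mem: "1 \<in> {1..n}" "n \<in> {1..n}" "j \<in> {1..n}" "k \<in> {1..n}"
    using n j(1,2) k(1,2) by simp_all
  have neq: "block_of P j \<noteq> ?L" "block_of P k \<noteq> ?R"
    using block_of_eq_iff[OF P mem(1,3)] block_of_eq_iff[OF P mem(2,4)] j(3) k(3) by simp_all
  have blocks: "{?L, block_of P j} \<subseteq> P" "{?R, block_of P k} \<subseteq> P"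
    using mem[THEN block_of_mem(1)[OF P]] by simp_all
  \<comment> \<open>With at least two blocks, neither second block is empty.\<close>
  have "?E \<longleftrightarrow> \<Union>{?L, block_of P j} = \<Union>{?R, block_of P k}"
    unfolding first_left_def second_left_def first_right_def second_right_def
      j_def k_def left_break_def right_break_def
    using False R by (simp del: One_nat_def)
  also have "\<dots> \<longleftrightarrow> {?L, block_of P j} = {?R, block_of P k}"
    by (rule partition_on_Union_eq_iff[OF P blocks])
  also have "\<dots> \<longleftrightarrow> ?L = ?R \<and> block_of P j = block_of P k \<or> block_of P j = ?R \<and> block_of P k = ?L"
    by (auto simp: doubleton_eq_iff)
  also have "?L = ?R \<and> block_of P j = block_of P k \<longleftrightarrow> ?N"
  proof
    assume *: "?L = ?R \<and> block_of P j = block_of P k"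
    have "j \<le> k"
    proof (rule ccontr)
      assume "\<not> j \<le> k"
      then have "j \<in> {k<..n}" using j(2) by simp
      then show False using k(4) j(3) * by blast
    qed
    then have "separates P ({1..<j} \<union> {k<..n}) {j, k}" "(j, k) \<in> nested_indices n"
      using separates_nested_iff[OF P j(1) _ k(2)] * False j_def k_def j(1) k(2)
      by (metis, simp add: nested_indices_def)
    then show ?N by blast
  next
    assume ?N
    then obtain j' k' where jk': "(j', k') \<in> nested_indices n"
      and sep: "separates P ({1..<j'} \<union> {k'<..n}) {j', k'}" by blast
    from jk' have "1 < j'" "j' \<le> k'" "k' < n" by (auto simp: nested_indices_def)
    from sep[unfolded separates_nested_iff[OF P this]]
    show "?L = ?R \<and> block_of P j = block_of P k" unfolding j_def k_def by metis
  qed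
  also have "block_of P j = ?R \<and> block_of P k = ?L \<longleftrightarrow> ?K"
  proof
    assume *: "block_of P j = ?R \<and> block_of P k = ?L"
    then have LR: "?L \<noteq> ?R" using neq by metis
    then have disj: "?L \<inter> ?R = {}"
      using partition_on_unique_block[OF P, of ?L ?R] mem(1,2)[THEN block_of_mem(1)[OF P]] by blast
    have "j \<noteq> k" using neq * by metis
    moreover have "j = Suc k" if "k < j"
    proof (rule ccontr)
      assume "j \<noteq> Suc k"
      then have "Suc k \<in> {1..<j}" "Suc k \<in> {k<..n}" using that j(2) by simp_all
      then show False using j(4) k(4) disj by blast
    qed
    ultimately have "j < k \<or> j = Suc k" by linarith
    then have "separates P (insert k {1..<j}) (insert j {k<..n})" "(j, k) \<in> crossed_indices n"
      using separates_crossed_iff[OF P j(1,2) k(1,2)] * LR j_def k_def j(1,2) k(1,2)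
      by (metis, simp add: crossed_indices_def)
    then show ?K by blast
  next
    assume ?K
    then obtain j' k' where jk': "(j', k') \<in> crossed_indices n"
      and sep: "separates P (insert k' {1..<j'}) (insert j' {k'<..n})" by blast
    from jk' have "1 < j'" "j' \<le> n" "1 \<le> k'" "k' < n" by (auto simp: crossed_indices_def)
    from sep[unfolded separates_crossed_iff[OF P this]]
    show "block_of P j = ?R \<and> block_of P k = ?L" unfolding j_def k_def by metis
  qed
  finally show ?thesis using False by blast
qed


section \<open>Summation over the patterns\<close>

lemma finite_nested_indices: "finite (nested_indices n)"
  by (rule finite_subset[of _ "{1..n} \<times> {1..n}"]) (auto simp: nested_indices_def)

lemma finite_crossed_indices: "finite (crossed_indices n)"
  by (rule finite_subset[of _ "{1..n} \<times> {1..n}"]) (auto simp: crossed_indices_def)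

lemma sum_nested_indices:
  fixes f :: "nat \<times> nat \<Rightarrow> real"
  shows "sum f (nested_indices n) =
    (\<Sum>j\<in>{1<..<n}. f (j, j)) + sum f {(j, k). 1 < j \<and> j < k \<and> k < n}"
proof -
  have "nested_indices n = (\<lambda>j. (j, j)) ` {1<..<n} \<union> {(j, k). 1 < j \<and> j < k \<and> k < n}"
    by (auto simp: nested_indices_def image_iff)
  moreover have "finite {(j, k). 1 < j \<and> j < k \<and> k < n}"
    by (rule finite_subset[OF _ finite_nested_indices[of n]]) (auto simp: nested_indices_def)
  moreover have "(\<lambda>j. (j, j)) ` {1<..<n} \<inter> {(j, k). 1 < j \<and> j < k \<and> k < n} = {}" by auto
  ultimately show ?thesis
    by (simp add: sum.union_disjoint sum.reindex inj_on_def)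
qed

lemma sum_crossed_indices:
  fixes f :: "nat \<times> nat \<Rightarrow> real"
  shows "sum f (crossed_indices n) =
    (\<Sum>i = 1..n - 1. f (Suc i, i)) + sum f {(j, k). 1 < j \<and> j < k \<and> k < n}"
proof -
  have "crossed_indices n = (\<lambda>i. (Suc i, i)) ` {1..n - 1} \<union> {(j, k). 1 < j \<and> j < k \<and> k < n}"
    by (auto simp: crossed_indices_def image_iff)
  moreover have "finite {(j, k). 1 < j \<and> j < k \<and> k < n}"
    by (rule finite_subset[OF _ finite_nested_indices[of n]]) (auto simp: nested_indices_def)
  moreover have "(\<lambda>i. (Suc i, i)) ` {1..n - 1} \<inter> {(j, k). 1 < j \<and> j < k \<and> k < n} = {}" by auto
  ultimately show ?thesis
    by (simp add: sum.union_disjoint sum.reindex inj_on_def)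
qed

theorem proposition6p1:
  fixes M :: "'a measure"
    and X :: "nat \<Rightarrow> 'a \<Rightarrow> nat set set"
    and p :: "nat list \<Rightarrow> real"
    and n :: nat
  assumes "prob_space M"
    and "consistent_exchangeable_partitions M X"
    and "is_EPPF p M X"
    and "n \<ge> 3"
  shows "u2 M X n =
      p [n]
    + (real n - 2) * p [n - 1, 1]
    + (\<Sum>(j, k)\<in>{(j, k). 1 < j \<and> j < k \<and> k < n}. p [(j - 1) + (n - k), 2])
    + (\<Sum>j = 1..n - 1. p [j, n - j])
    + (\<Sum>(j, k)\<in>{(j, k). 1 < j \<and> j < k \<and> k < n}. p [j, n - k + 1])"
proof -
  interpret prob_space M by fact
  have n: "1 \<le> n" using assms(4) by simp
  have exch: "exchangeable_partition M n (X n)"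
    using assms(2) n by (simp add: consistent_exchangeable_partitions_def)
  then have rp: "random_partition M n (X n)" by (simp add: exchangeable_partition_def)
  have part: "partition_on {1..n} (X n \<omega>)" if "\<omega> \<in> space M" for \<omega>
    using rp that by (rule random_partition_partition_on)
  define T where "T = {\<omega> \<in> space M. block_of (X n \<omega>) 1 = {1..n}}"
  define N where "N = (\<lambda>(j, k). {\<omega> \<in> space M. separates (X n \<omega>) ({1..<j} \<union> {k<..n}) {j, k}})"
  define K where "K = (\<lambda>(j, k). {\<omega> \<in> space M.
    separates (X n \<omega>) (insert k {1..<j}) (insert j {k<..n})})"
  have sets: "T \<in> events" "N i \<in> events" "K i \<in> events" for i
    by (auto simp: T_def N_def K_def split_def intro!: random_partition_event_sets[OF rp])
  \<comment> \<open>The three kinds of events are told apart by whether the block of \<open>1\<close> is everything and whether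
    it contains \<open>n\<close>; within a kind, the breaks recover the index.\<close>
  have N_D: "block_of (X n \<omega>) 1 \<noteq> {1..n}" "block_of (X n \<omega>) 1 = block_of (X n \<omega>) n"
      "i = (left_break n (X n \<omega>), right_break n (X n \<omega>))"
    if "\<omega> \<in> N i" "i \<in> nested_indices n" for \<omega> i
  proof -
    obtain j k where i: "i = (j, k)" by (cases i)
    have w: "\<omega> \<in> space M" using that by (auto simp: N_def i)
    have jk: "1 < j" "j \<le> k" "k < n" using that by (auto simp: nested_indices_def i)
    have "separates (X n \<omega>) ({1..<j} \<union> {k<..n}) {j, k}" using that by (simp add: N_def i)
    then show "block_of (X n \<omega>) 1 \<noteq> {1..n}" "block_of (X n \<omega>) 1 = block_of (X n \<omega>) n"
      "i = (left_break n (X n \<omega>), right_break n (X n \<omega>))"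
      unfolding separates_nested_iff[OF part[OF w] jk] by (auto simp: i)
  qed
  have K_D: "block_of (X n \<omega>) 1 \<noteq> {1..n}" "block_of (X n \<omega>) 1 \<noteq> block_of (X n \<omega>) n"
      "i = (left_break n (X n \<omega>), right_break n (X n \<omega>))"
    if "\<omega> \<in> K i" "i \<in> crossed_indices n" for \<omega> i
  proof -
    obtain j k where i: "i = (j, k)" by (cases i)
    have w: "\<omega> \<in> space M" using that by (auto simp: K_def i)
    have jk: "1 < j" "j \<le> n" "1 \<le> k" "k < n"
      using that by (auto simp: crossed_indices_def i)
    have "separates (X n \<omega>) (insert k {1..<j}) (insert j {k<..n})" using that by (simp add: K_def i)
    then show *: "block_of (X n \<omega>) 1 \<noteq> block_of (X n \<omega>) n"
      "i = (left_break n (X n \<omega>), right_break n (X n \<omega>))"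
      unfolding separates_crossed_iff[OF part[OF w] jk] by (auto simp: i)
    have "1 \<in> {1..n}" "n \<in> {1..n}" using n by simp_all
    then show "block_of (X n \<omega>) 1 \<noteq> {1..n}"
      using block_of_eq_iff[OF part[OF w], of 1 n] *(1) by metis
  qed
  let ?UN = "\<Union>i\<in>nested_indices n. N i" and ?UK = "\<Union>i\<in>crossed_indices n. K i"
  have UN: "?UN = {\<omega> \<in> space M.
      \<exists>(j, k)\<in>nested_indices n. separates (X n \<omega>) ({1..<j} \<union> {k<..n}) {j, k}}"
    by (auto simp: N_def split_def)
  have UK: "?UK = {\<omega> \<in> space M.
      \<exists>(j, k)\<in>crossed_indices n. separates (X n \<omega>) (insert k {1..<j}) (insert j {k<..n})}"
    by (auto simp: K_def split_def)
  have "{\<omega> \<in> space M.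
       first_left n (X n \<omega>) \<union> second_left n (X n \<omega>) =
       first_right n (X n \<omega>) \<union> second_right n (X n \<omega>)} = T \<union> (?UN \<union> ?UK)"
    unfolding T_def UN UK Collect_disj_eq[symmetric] conj_disj_distribL[symmetric]
    by (intro Collect_cong conj_cong refl two_block_unions_eq_iff part n)
  then have "u2 M X n = prob (T \<union> (?UN \<union> ?UK))" by (simp only: u2_def)
  also have "\<dots> = prob T + prob (?UN \<union> ?UK)"
  proof (rule finite_measure_Union)
    show "?UN \<union> ?UK \<in> events"
      using sets finite_nested_indices finite_crossed_indices by (intro sets.Un sets.finite_UN) auto
    show "T \<inter> (?UN \<union> ?UK) = {}" using N_D(1) K_D(1) unfolding T_def by blast
  qed (rule sets)
  also have "prob (?UN \<union> ?UK) = prob ?UN + prob ?UK"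
  proof (rule finite_measure_Union)
    show "?UN \<inter> ?UK = {}" using N_D(2) K_D(2) by blast
  qed (use sets finite_nested_indices finite_crossed_indices in \<open>auto intro!: sets.finite_UN\<close>)
  also have "prob ?UN = (\<Sum>i\<in>nested_indices n. prob (N i))"
  proof (rule finite_measure_finite_Union)
    show "disjoint_family_on N (nested_indices n)"
      unfolding disjoint_family_on_def using N_D(3) by (metis disjoint_iff)
  qed (use sets finite_nested_indices in auto)
  also have "prob ?UK = (\<Sum>i\<in>crossed_indices n. prob (K i))"
  proof (rule finite_measure_finite_Union)
    show "disjoint_family_on K (crossed_indices n)"
      unfolding disjoint_family_on_def using K_D(3) by (metis disjoint_iff)
  qed (use sets finite_crossed_indices in auto)
  finally have u2: "u2 M X n =
    prob T + ((\<Sum>i\<in>nested_indices n. prob (N i)) + (\<Sum>i\<in>crossed_indices n. prob (K i)))" .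

  have "block_of (X n \<omega>) 1 = {1..n} \<longleftrightarrow> restrict_partition {1..n} (X n \<omega>) = {{1..n}}"
    if "\<omega> \<in> space M" for \<omega>
  proof -
    note P = part[OF that]
    have "block_of (X n \<omega>) 1 = {1..n} \<longleftrightarrow> X n \<omega> = {{1..n}}"
      using block_of_eq_whole_iff[OF P, of 1] n by simp
    then show ?thesis unfolding restrict_partition_whole[OF P] .
  qed
  then have "T = {\<omega> \<in> space M. restrict_partition {1..n} (X n \<omega>) = {{1..n}}}"
    by (auto simp: T_def)
  also have "prob \<dots> = p [n]"
    using n by (intro measure_restrict_partition_eq[OF exch assms(3)] partition_on_space)
      (auto simp: composition_def)
  finally have T: "prob T = p [n]" .

  have N: "prob (N (j, k)) = p [(j - 1) + (n - k), card {j, k}]"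
    if "1 < j" "j \<le> k" "k < n" for j k
  proof -
    have "card ({1..<j} \<union> {k<..n}) = (j - 1) + (n - k)"
      using that by (subst card_Un_disjoint) auto
    moreover have "prob (N (j, k)) = p [card ({1..<j} \<union> {k<..n}), card {j, k}]"
      unfolding N_def prod.case
      by (rule measure_separates[OF exch assms(3)]) (use that in auto)
    ultimately show ?thesis by simp
  qed
  have "(\<Sum>i\<in>nested_indices n. prob (N i)) =
    (\<Sum>j\<in>{1<..<n}. p [n - 1, 1]) +
    (\<Sum>(j, k)\<in>{(j, k). 1 < j \<and> j < k \<and> k < n}. p [(j - 1) + (n - k), 2])"
    unfolding sum_nested_indices
  proof (intro arg_cong2[where f = "(+)"] sum.cong refl)
    fix j assume j: "j \<in> {1<..<n}"
    then have "(j - 1) + (n - j) = n - 1" by auto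
    then show "prob (N (j, j)) = p [n - 1, 1]" using N[of j j] j by simp
  qed (auto simp: N numeral_2_eq_2)
  also have "(\<Sum>j\<in>{1<..<n}. p [n - 1, 1]) = (real n - 2) * p [n - 1, 1]"
    using assms(4) by (simp add: of_nat_diff)
  finally have SN: "(\<Sum>i\<in>nested_indices n. prob (N i)) = (real n - 2) * p [n - 1, 1] +
    (\<Sum>(j, k)\<in>{(j, k). 1 < j \<and> j < k \<and> k < n}. p [(j - 1) + (n - k), 2])" .

  have K: "prob (K (j, k)) = p [card (insert k {1..<j}), card (insert j {k<..n})]"
    if "(j, k) \<in> crossed_indices n" for j k
    unfolding K_def prod.case
    by (rule measure_separates[OF exch assms(3)]) (use that in \<open>auto simp: crossed_indices_def\<close>)
  have SK: "(\<Sum>i\<in>crossed_indices n. prob (K i)) =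
    (\<Sum>j = 1..n - 1. p [j, n - j]) +
    (\<Sum>(j, k)\<in>{(j, k). 1 < j \<and> j < k \<and> k < n}. p [j, n - k + 1])"
    unfolding sum_crossed_indices
  proof (intro arg_cong2[where f = "(+)"] sum.cong refl)
    fix i assume i: "i \<in> {1..n - 1}"
    then have idx: "(Suc i, i) \<in> crossed_indices n" by (auto simp: crossed_indices_def)
    \<comment> \<open>The index \<open>(Suc i, i)\<close> is the partition into the intervals \<open>{1..i}\<close> and \<open>{i<..n}\<close>.\<close>
    have "insert i {1..<Suc i} = {1..i}" "insert (Suc i) {i<..n} = {i<..n}" using i by auto
    then show "prob (K (Suc i, i)) = p [i, n - i]" using K[OF idx] by simp
  next
    fix i assume "i \<in> {(j, k). 1 < j \<and> j < k \<and> k < n}"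
    then obtain j k where i: "i = (j, k)" "1 < j" "j < k" "k < n" by auto
    then have idx: "(j, k) \<in> crossed_indices n" by (auto simp: crossed_indices_def)
    have "card (insert k {1..<j}) = j" "card (insert j {k<..n}) = n - k + 1" using i by auto
    then show "prob (K i) = (case i of (j, k) \<Rightarrow> p [j, n - k + 1])"
      using K[OF idx] by (simp add: i(1))
  qed
  show ?thesis unfolding u2 T SN SK by simp
qed

end
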